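(* For every finite simple graph $G$ there exist infinitely many pairwise non-isomorphic finite simple graphs $G^*$ such that $X(G^* )\cong G$, where $X(\cdot)$ denotes the mincut graph operator.
   Context: All graphs are finite and simple (not necessarily connected unless stated). For a connected graph $H$, an edge-cut of $H$ is a subset $S\subseteq E(H)$ such that $H-S$ is disconnected; a mincut of $H$ is an edge-cut of minimum cardinality, and this cardinality is the edge-connectivity $\lambda(H)$. The mincut graph $X(H)$ of $H$ is the intersection graph of the mincuts: it has one vertex for each mincut of $H$, and two distinct vertices are adjacent if and only if the corresponding mincuts have non-empty intersection (as sets of edges). If $H$ is disconnected (or has no edge-cut), $X(H)$ is the null graph $K_0$, with no vertices and no edges. *)

theory Defs
  imports "Graph_Theory.Pair_Digraph" "Graph_Theory.Digraph_Isomorphism"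
begin

text \<open>
  A finite simple graph is a \<^locale>\<open>pair_graph\<close>: finite, loop-free and symmetric, without parallel
  arcs because an arc is its pair of end points. An undirected edge \<open>uv\<close> is thus represented by
  the two arcs \<open>(u, v)\<close> and \<open>(v, u)\<close>. Since cut sizes count undirected edges, edge sets below are
  sets of two-element vertex sets and not sets of arcs.
\<close>

definition uedges :: "'a pair_pre_digraph \<Rightarrow> 'a set set" where
  "uedges H = (\<lambda>(u, v). {u, v}) ` parcs H"

definition del_uedges :: "'a pair_pre_digraph \<Rightarrow> 'a set set \<Rightarrow> 'a pair_pre_digraph" where
  "del_uedges H S = H\<lparr>parcs := {(u, v) \<in> parcs H. {u, v} \<notin> S}\<rparr>"

text \<open>
  Edge-cuts exist for connected graphs only, so a disconnected graph has no mincuts. The library's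
  \<^const>\<open>connected\<close> demands a nonempty vertex set; hence the null graph has no mincuts either, and
  as deleting edges keeps the vertices, \<open>\<not> connected\<close> below really means a pair of vertices not
  joined by a path.
\<close>

definition edge_cut :: "'a pair_pre_digraph \<Rightarrow> 'a set set \<Rightarrow> bool" where
  "edge_cut H S \<longleftrightarrow>
     connected (with_proj H) \<and> S \<subseteq> uedges H \<and> \<not> connected (with_proj (del_uedges H S))"

definition mincut :: "'a pair_pre_digraph \<Rightarrow> 'a set set \<Rightarrow> bool" where
  "mincut H S \<longleftrightarrow> is_arg_min card (edge_cut H) S"

definition mincut_graph :: "'a pair_pre_digraph \<Rightarrow> 'a set set pair_pre_digraph" where
  "mincut_graph H =
     \<lparr>pverts = {S. mincut H S},
      parcs = {(S, T). mincut H S \<and> mincut H T \<and> S \<noteq> T \<and> S \<inter> T \<noteq> {}}\<rparr>"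

lemma pair_graph_mincut_graph:
  assumes "pair_graph H"
  shows "pair_graph (mincut_graph H)"
proof -
  interpret pair_graph H by fact
  have "finite (uedges H)"
    unfolding uedges_def using pair_finite_arcs by simp
  moreover have "{S. mincut H S} \<subseteq> Pow (uedges H)"
    by (auto simp: mincut_def is_arg_min_def edge_cut_def)
  ultimately have fin: "finite {S. mincut H S}"
    by (meson finite_Pow_iff finite_subset)
  have "parcs (mincut_graph H) \<subseteq> {S. mincut H S} \<times> {S. mincut H S}"
    by (auto simp: mincut_graph_def)
  then have fin': "finite (parcs (mincut_graph H))"
    using fin by (meson finite_SigmaI finite_subset)
  interpret M: pair_wf_digraph "mincut_graph H"
    by unfold_locales (auto simp: mincut_graph_def)
  show ?thesis
    by unfold_locales
      (use fin fin' in \<open>auto simp: mincut_graph_def symmetric_def arcs_ends_conv intro!: symI\<close>)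
qed

end

theory Submission
  imports Defs
begin

text \<open>
  Attach \<open>G\<close> to a large clique so that every vertex of \<open>G\<close> gets the same degree \<open>k\<close>, with more than
  half of its edges going to the clique. A cut that splits the clique has more than \<open>k\<close> edges, and so
  has a cut that separates two or more vertices of \<open>G\<close> from the clique. Hence the mincuts are exactly
  the stars of the vertices of \<open>G\<close>, and two such stars share an edge if and only if their centres are
  adjacent. Varying the size of the clique gives infinitely many graphs. If \<open>G\<close> is null, edgeless
  graphs with at least two vertices do.
\<close>

section \<open>Cuts and boundaries\<close>

text \<open>This is the edge boundary of \<open>A\<close>, the cut between \<open>A\<close> and its
  complement. It consists of two-element sets, like \<open>uedges\<close>, so its cardinality counts
  undirected edges.\<close>

definition boundary :: "'a pair_pre_digraph \<Rightarrow> 'a set \<Rightarrow> 'a set set" where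
  "boundary H A = {{u, v} |u v. (u, v) \<in> parcs H \<and> u \<in> A \<and> v \<notin> A}"

lemma boundaryI: "(u, v) \<in> parcs H \<Longrightarrow> u \<in> A \<Longrightarrow> v \<notin> A \<Longrightarrow> {u, v} \<in> boundary H A"
  by (auto simp: boundary_def)

lemma boundary_subset_uedges: "boundary H A \<subseteq> uedges H"
  by (force simp: boundary_def uedges_def)

lemma (in pair_fin_digraph) finite_uedges: "finite (uedges G)"
  unfolding uedges_def using pair_finite_arcs by simp

lemma (in pair_fin_digraph) finite_boundary: "finite (boundary G A)"
  using boundary_subset_uedges finite_uedges by (rule finite_subset)

text \<open>Symmetry reverses each crossing arc, and well-formedness places its outer end in
  \<open>pverts G\<close>. This allows passing to the side of a cut that misses the clique.\<close>

lemma (in pair_sym_digraph) boundary_Compl: "boundary G (pverts G - A) = boundary G A"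
proof -
  have "{u, v} \<in> boundary G A" if "(u, v) \<in> parcs G" "u \<notin> A" "v \<in> A" for u v
    using boundaryI[OF arcs_symmetric[OF that(1)] that(3,2)] by (simp add: insert_commute)
  moreover have "{u, v} \<in> boundary G (pverts G - A)" if uv: "(u, v) \<in> parcs G" "u \<in> A" "v \<notin> A" for u v
    using boundaryI[OF arcs_symmetric[OF uv(1)], of "pverts G - A"] uv in_arcsD2[OF uv(1)]
    by (simp add: insert_commute)
  ultimately show ?thesis
    by (fastforce simp: boundary_def[of G "pverts G - A"] boundary_def[of G A] dest: in_arcsD2)
qed

text \<open>A path from \<open>A\<close> to its complement has an arc that leaves \<open>A\<close>;
  conversely, no arc leaves the set of vertices reachable from a given one. This reduces
  connectedness to boundaries.\<close>

lemma (in pair_sym_digraph) connected_iff_arc_leaving: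
  "connected (with_proj G) \<longleftrightarrow>
     pverts G \<noteq> {} \<and> (\<forall>A. A \<noteq> {} \<longrightarrow> A \<subset> pverts G \<longrightarrow> (\<exists>u v. (u, v) \<in> parcs G \<and> u \<in> A \<and> v \<notin> A))"
proof -
  \<comment> \<open>The library defines \<open>connected\<close> through the symmetric closure,
    which has the same reachability as a graph that is already symmetric.\<close>
  have sc: "connected (with_proj G) \<longleftrightarrow> strongly_connected (with_proj G)"
    using symmetric_connected_imp_strongly_connected[OF pair_sym_arcs]
    by (auto simp: connected_def strongly_connected_def intro: reachable_mk_symmetricI)
  show ?thesis
    unfolding sc
  proof (intro iffI conjI allI impI)
    assume "strongly_connected (with_proj G)"
    then show "pverts G \<noteq> {}"
      by (auto simp: strongly_connected_def)
  next
    fix A assume conn: "strongly_connected (with_proj G)" and A: "A \<noteq> {}" "A \<subset> pverts G"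
    obtain a b where ab: "a \<in> A" "b \<in> pverts G" "b \<notin> A"
      using A by auto
    then have "a \<rightarrow>\<^sup>*\<^bsub>with_proj G\<^esub> b"
      using conn A by (auto simp: strongly_connected_def)
    then show "\<exists>u v. (u, v) \<in> parcs G \<and> u \<in> A \<and> v \<notin> A"
      using \<open>b \<notin> A\<close> \<open>a \<in> A\<close>
      by (induction rule: reachable_induct) auto
  next
    assume R: "pverts G \<noteq> {} \<and> (\<forall>A. A \<noteq> {} \<longrightarrow> A \<subset> pverts G \<longrightarrow>
      (\<exists>u v. (u, v) \<in> parcs G \<and> u \<in> A \<and> v \<notin> A))"
    have "a \<rightarrow>\<^sup>*\<^bsub>with_proj G\<^esub> b" if "a \<in> pverts G" "b \<in> pverts G" for a b
    proof (rule ccontr)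
      let ?A = "{v \<in> pverts G. a \<rightarrow>\<^sup>*\<^bsub>with_proj G\<^esub> v}"
      assume "\<not> a \<rightarrow>\<^sup>*\<^bsub>with_proj G\<^esub> b"
      then have "?A \<noteq> {}" "?A \<subset> pverts G"
        using that by auto
      then obtain u v where "(u, v) \<in> parcs G" "u \<in> ?A" "v \<notin> ?A"
        using R by meson
      then show False
        using reachable_adj_trans[of a u v] in_arcsD2 by auto
    qed
    then show "strongly_connected (with_proj G)"
      using R by (auto simp: strongly_connected_def)
  qed
qed

text \<open>Deleting \<open>S\<close> leaves no arc out of \<open>A\<close> exactly when
  \<open>S\<close> contains the boundary of \<open>A\<close>. Hence small edge-cuts can be studied
  through small boundaries.\<close>

lemma (in pair_graph) edge_cut_iff_boundary:
  "edge_cut G S \<longleftrightarrow> connected (with_proj G) \<and> S \<subseteq> uedges G \<and>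
     (\<exists>A. A \<noteq> {} \<and> A \<subset> pverts G \<and> boundary G A \<subseteq> S)"
proof (cases "connected (with_proj G)")
  case True
  interpret D: pair_sym_digraph "del_uedges G S"
    by unfold_locales
      (auto simp: del_uedges_def symmetric_def insert_commute
        intro!: symI intro: in_arcsD1 in_arcsD2 arcs_symmetric)
  have "pverts G \<noteq> {}"
    using True connected_iff_arc_leaving by blast
  moreover have "(\<nexists>u v. (u, v) \<in> parcs (del_uedges G S) \<and> u \<in> A \<and> v \<notin> A) \<longleftrightarrow> boundary G A \<subseteq> S" for A
    by (auto simp: del_uedges_def boundary_def)
  ultimately show ?thesis
    unfolding edge_cut_def D.connected_iff_arc_leaving
    by (simp add: del_uedges_def)
qed (simp add: edge_cut_def)

section \<open>Extensions of a graph by a large clique\<close>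

definition nbrs :: "'a pair_pre_digraph \<Rightarrow> 'a \<Rightarrow> 'a set" where
  "nbrs H v = {w. (v, w) \<in> parcs H}"

text \<open>The form as an injective image of the neighbourhood makes its size the degree of
  \<open>v\<close>.\<close>

definition star :: "'a pair_pre_digraph \<Rightarrow> 'a \<Rightarrow> 'a set set" where
  "star H v = (\<lambda>w. {v, w}) ` nbrs H v"

lemma inj_on_doubleton: "inj_on (\<lambda>w. {v, w}) A"
  by (auto simp: inj_on_def doubleton_eq_iff)

lemma (in pair_loopfree_digraph) star_eq_boundary: "star G v = boundary G {v}"
  by (auto simp: star_def nbrs_def boundary_def dest: no_loops')

lemma (in pair_fin_digraph) finite_nbrs: "finite (nbrs G v)"
  by (rule finite_subset[OF _ pair_finite_verts]) (auto simp: nbrs_def intro: in_arcsD2)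

text \<open>\<open>V\<close> stands for the vertices of the given graph and \<open>K\<close> for the
  attached clique. The last two assumptions make every cut other than a star of a vertex in
  \<open>V\<close> larger than \<open>k\<close>: the first for cuts that isolate several vertices of
  \<open>V\<close>, the second for cuts that split \<open>K\<close>.\<close>

locale clique_extension = pair_graph H for H :: "'b pair_pre_digraph" +
  fixes V K :: "'b set" and k :: nat
  assumes V_nonempty: "V \<noteq> {}"
    and pverts_eq: "pverts H = V \<union> K"
    and disjoint: "V \<inter> K = {}"
    and clique: "x \<in> K \<Longrightarrow> y \<in> K \<Longrightarrow> x \<noteq> y \<Longrightarrow> (x, y) \<in> parcs H"
    and card_nbrs: "v \<in> V \<Longrightarrow> card (nbrs H v) = k"
    and most_nbrs_in_clique: "v \<in> V \<Longrightarrow> k < 2 * card (nbrs H v \<inter> K)"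
    and clique_large: "Suc k < card K"
begin

lemma finite_V: "finite V" and finite_K: "finite K"
  using pair_finite_verts by (auto simp: pverts_eq)

lemma nbr_in_clique: "v \<in> V \<Longrightarrow> nbrs H v \<inter> K \<noteq> {}"
  using most_nbrs_in_clique by fastforce

section \<open>Boundaries with at most k edges\<close>

lemma card_boundary_splitting_clique:
  assumes "x \<in> A \<inter> K" "y \<in> K - A"
  shows "k < card (boundary H A)"
proof -
  \<comment> \<open>Each clique vertex \<open>z\<close> gives a crossing edge, to \<open>y\<close>
    or to \<open>x\<close> according to its side. Leaving out \<open>x\<close> makes
    \<open>e\<close> injective, as \<open>e x\<close> and \<open>e y\<close> would coincide;
    \<open>card K - 1\<close> edges remain.\<close>
  define e where "e z = (if z \<in> A then {z, y} else {x, z})" for z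
  have "inj_on e (K - {x})"
    using assms by (auto simp: inj_on_def e_def doubleton_eq_iff)
  moreover have "e ` (K - {x}) \<subseteq> boundary H A"
    using assms by (auto simp: e_def intro!: boundaryI clique)
  ultimately have "card (K - {x}) \<le> card (boundary H A)"
    using finite_boundary card_inj_on_le by blast
  moreover have "card (K - {x}) = card K - 1"
    using assms finite_K by simp
  ultimately show ?thesis
    using clique_large by simp
qed

text \<open>The edges from \<open>u\<close> to the clique and those from \<open>v\<close> to the
  clique all leave \<open>B\<close>. The two sets are disjoint, and each has more than half of
  \<open>k\<close> elements.\<close>

lemma card_boundary_two_vertices:
  assumes "B \<subseteq> V" "u \<in> B" "v \<in> B" "u \<noteq> v"
  shows "k < card (boundary H B)"
proof -
  let ?e = "\<lambda>x. (\<lambda>w. {x, w}) ` (nbrs H x \<inter> K)"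
  have "?e u \<union> ?e v \<subseteq> boundary H B"
    using assms disjoint by (auto simp: nbrs_def intro!: boundaryI)
  then have "card (?e u \<union> ?e v) \<le> card (boundary H B)"
    by (intro card_mono finite_boundary)
  moreover have "?e u \<inter> ?e v = {}"
    using assms disjoint by (auto simp: doubleton_eq_iff)
  then have "card (?e u \<union> ?e v) = card (?e u) + card (?e v)"
    using finite_nbrs by (intro card_Un_disjoint) auto
  moreover have "card (?e u) = card (nbrs H u \<inter> K)" "card (?e v) = card (nbrs H v \<inter> K)"
    by (intro card_image inj_on_doubleton)+
  moreover have "k < 2 * card (nbrs H u \<inter> K)" "k < 2 * card (nbrs H v \<inter> K)"
    using assms most_nbrs_in_clique by auto
  ultimately show ?thesis
    by linarith
qed

lemma card_star: "v \<in> V \<Longrightarrow> card (star H v) = k"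
  unfolding star_def by (simp add: card_image inj_on_doubleton card_nbrs)

text \<open>As \<open>A\<close> cannot split the clique, \<open>A\<close> or its complement lies in
  \<open>V\<close>. That side has the same boundary and cannot contain two vertices.\<close>

lemma small_boundary_is_star:
  assumes "A \<noteq> {}" "A \<subset> pverts H" "card (boundary H A) \<le> k"
  obtains v where "v \<in> V" "boundary H A = star H v"
proof -
  have side: "\<exists>v\<in>V. boundary H A = star H v"
    if B: "B \<noteq> {}" "B \<subseteq> V" "boundary H B = boundary H A" for B
  proof -
    obtain v where "v \<in> B"
      using B by auto
    moreover have "u = v" if "u \<in> B" for u
      using card_boundary_two_vertices[of B u v] B \<open>v \<in> B\<close> that assms by fastforce
    ultimately have "B = {v}"
      by blast
    then show ?thesis
      using B star_eq_boundary by (intro bexI[of _ v]) auto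
  qed
  consider "A \<inter> K = {}" | "K \<subseteq> A"
    using card_boundary_splitting_clique assms by (meson DiffI disjoint_iff IntI leD subsetI)
  then have "\<exists>v\<in>V. boundary H A = star H v"
  proof cases
    case 1
    then show ?thesis
      using assms pverts_eq by (intro side[of A]) auto
  next
    case 2
    then show ?thesis
      using assms pverts_eq boundary_Compl[of A] by (intro side[of "pverts H - A"]) blast+
  qed
  then show thesis
    using that by blast
qed

text \<open>An empty boundary would be small and hence a star, but each vertex of \<open>V\<close>
  has a neighbour in the clique.\<close>

lemma connected_H: "connected (with_proj H)"
  unfolding connected_iff_arc_leaving
proof (intro conjI allI impI)
  show "pverts H \<noteq> {}"
    using V_nonempty pverts_eq by auto
  fix A assume A: "A \<noteq> {}" "A \<subset> pverts H"
  have "boundary H A \<noteq> {}"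
  proof
    assume empty: "boundary H A = {}"
    then obtain v where "v \<in> V" "star H v = {}"
      using small_boundary_is_star[OF A] by (metis card.empty le0)
    then show False
      using nbr_in_clique by (auto simp: star_def)
  qed
  then show "\<exists>u v. (u, v) \<in> parcs H \<and> u \<in> A \<and> v \<notin> A"
    by (auto simp: boundary_def)
qed

section \<open>Mincuts and their intersections\<close>

lemma edge_cut_star: "v \<in> V \<Longrightarrow> edge_cut H (star H v)"
proof -
  assume "v \<in> V"
  moreover have "K \<noteq> {}"
    using clique_large by auto
  ultimately have "{v} \<subset> pverts H"
    using disjoint pverts_eq by auto
  then show ?thesis
    unfolding edge_cut_iff_boundary star_eq_boundary
    using connected_H boundary_subset_uedges by blast
qed

text \<open>The cut contains a boundary, which is again small and so a star. A star already has
  \<open>k\<close> elements, which forces equality.\<close>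

lemma small_edge_cut_is_star:
  assumes "edge_cut H S" "card S \<le> k"
  shows "S \<in> star H ` V"
proof -
  obtain A where A: "A \<noteq> {}" "A \<subset> pverts H" "boundary H A \<subseteq> S" and "finite S"
    using assms finite_uedges unfolding edge_cut_iff_boundary by (meson finite_subset)
  then have "card (boundary H A) \<le> k"
    using assms card_mono by (metis le_trans)
  then obtain v where "v \<in> V" "boundary H A = star H v"
    using A small_boundary_is_star by blast
  moreover from this have "boundary H A = S"
    using A assms card_star \<open>finite S\<close> by (intro card_seteq) auto
  ultimately show ?thesis
    by auto
qed

text \<open>The stars are cuts of size \<open>k\<close>, and every cut with at most \<open>k\<close>
  edges is a star, so \<open>k\<close> is the edge-connectivity.\<close>

lemma mincut_iff_star: "mincut H S \<longleftrightarrow> S \<in> star H ` V"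
proof
  assume "mincut H S"
  moreover obtain v where "v \<in> V"
    using V_nonempty by auto
  ultimately show "S \<in> star H ` V"
    using small_edge_cut_is_star edge_cut_star[of v] card_star[of v]
    by (auto simp: mincut_def is_arg_min_linorder)
next
  assume "S \<in> star H ` V"
  then obtain v where v: "v \<in> V" "S = star H v"
    by auto
  have "k \<le> card T" if "edge_cut H T" for T
    using small_edge_cut_is_star[OF that] card_star by (metis imageE linorder_linear)
  then show "mincut H S"
    using v edge_cut_star card_star by (auto simp: mincut_def is_arg_min_linorder)
qed

text \<open>The edge from \<open>u\<close> to a clique neighbour \<open>w\<close> determines
  \<open>u\<close>, its only end in \<open>V\<close>.\<close>

lemma inj_on_star: "inj_on (star H) V"
proof (rule inj_onI)
  fix u v assume uv: "u \<in> V" "v \<in> V" "star H u = star H v"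
  obtain w where "w \<in> nbrs H u \<inter> K"
    using nbr_in_clique uv by blast
  then have "{u, w} \<in> star H v" "w \<noteq> v"
    using uv disjoint by (auto simp: star_def)
  then show "u = v"
    by (auto simp: star_def doubleton_eq_iff)
qed

text \<open>An edge in both stars contains both centres, so it joins them.\<close>

lemma stars_intersect_iff:
  assumes "u \<noteq> v"
  shows "star H u \<inter> star H v \<noteq> {} \<longleftrightarrow> (u, v) \<in> parcs H"
proof
  assume "star H u \<inter> star H v \<noteq> {}"
  then show "(u, v) \<in> parcs H"
    using assms by (auto simp: star_def nbrs_def doubleton_eq_iff)
next
  assume "(u, v) \<in> parcs H"
  then have "{u, v} \<in> star H u" "{v, u} \<in> star H v"
    by (auto simp: star_def nbrs_def arcs_symmetric)
  then show "star H u \<inter> star H v \<noteq> {}"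
    by (auto simp: insert_commute)
qed

end

section \<open>Isomorphisms\<close>

text \<open>Library isomorphisms carry maps for vertices, arcs, heads and tails. Here arcs are
  pairs, so the vertex bijection determines the rest.\<close>

lemma digraph_iso_with_projI:
  assumes "pair_wf_digraph G" "pair_wf_digraph H"
    and bij: "bij_betw f (pverts G) (pverts H)"
    and arcs: "\<And>u v. u \<in> pverts G \<Longrightarrow> v \<in> pverts G \<Longrightarrow> (f u, f v) \<in> parcs H \<longleftrightarrow> (u, v) \<in> parcs G"
  shows "digraph_iso (with_proj G) (with_proj H)"
proof -
  interpret G: pair_wf_digraph G by fact
  interpret H: pair_wf_digraph H by fact
  define hom where
    "hom = \<lparr>iso_verts = f, iso_arcs = map_prod f f, iso_head = snd, iso_tail = fst\<rparr>"
  have inj: "inj_on f (pverts G)" and img: "f ` pverts G = pverts H"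
    using bij by (auto simp: bij_betw_def)
  have sub: "parcs G \<subseteq> pverts G \<times> pverts G"
    by (auto intro: G.in_arcsD1 G.in_arcsD2)
  have "parcs H \<subseteq> map_prod f f ` parcs G"
  proof (rule subrelI)
    fix x y assume xy: "(x, y) \<in> parcs H"
    then have "x \<in> f ` pverts G" "y \<in> f ` pverts G"
      using img H.in_arcsD1 H.in_arcsD2 by auto
    then obtain u v where "x = f u" "y = f v" "u \<in> pverts G" "v \<in> pverts G"
      by auto
    then show "(x, y) \<in> map_prod f f ` parcs G"
      using xy arcs by force
  qed
  then have arcs_img: "map_prod f f ` parcs G = parcs H"
    using arcs sub by auto
  have "inj_on (map_prod f f) (parcs G)"
    using map_prod_inj_on[OF inj inj] sub by (rule inj_on_subset)
  then have "pre_digraph.digraph_isomorphism (with_proj G) hom"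
    unfolding pre_digraph.digraph_isomorphism_def
    using inj G.wf_digraph by (auto simp: hom_def)
  moreover have "with_proj H = app_iso hom (with_proj G)"
    by (simp add: app_iso_def hom_def img arcs_img with_proj_def)
  ultimately show ?thesis
    unfolding digraph_iso_def by blast
qed

text \<open>The number of vertices is the invariant that separates the graphs of the final
  family.\<close>

lemma digraph_iso_card_pverts:
  assumes "digraph_iso (with_proj G) (with_proj H)"
  shows "card (pverts G) = card (pverts H)"
proof -
  obtain hom where hom: "pre_digraph.digraph_isomorphism (with_proj G) hom"
    and H: "with_proj H = app_iso hom (with_proj G)"
    using assms unfolding digraph_iso_def by blast
  have "pverts H = iso_verts hom ` pverts G"
    using arg_cong[OF H, of verts] by simp
  then show ?thesis
    using card_verts_iso[OF hom] by simp
qed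

text \<open>Renumbering the vertices as an initial segment leaves the larger numbers free for the
  clique.\<close>

lemma ex_digraph_iso_lessThan:
  assumes "pair_graph G"
  obtains G' :: "nat pair_pre_digraph"
  where "pair_graph G'" "pverts G' = {..<card (pverts G)}" "digraph_iso (with_proj G') (with_proj G)"
proof -
  interpret pair_graph G by fact
  obtain f where f: "bij_betw f {..<card (pverts G)} (pverts G)"
    using ex_bij_betw_nat_finite[OF pair_finite_verts] by (auto simp: atLeast0LessThan)
  define G' where "G' = \<lparr>pverts = {..<card (pverts G)},
    parcs = {(i, j). i < card (pverts G) \<and> j < card (pverts G) \<and> (f i, f j) \<in> parcs G}\<rparr>"
  have "parcs G' \<subseteq> {..<card (pverts G)} \<times> {..<card (pverts G)}"
    by (auto simp: G'_def)
  then have "finite (parcs G')"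
    by (rule finite_subset) simp
  then have G': "pair_graph G'"
    by unfold_locales
      (auto simp: G'_def symmetric_def intro!: symI intro: arcs_symmetric dest: no_loops')
  interpret G': pair_graph G' by fact
  have "digraph_iso (with_proj G') (with_proj G)"
    using f G'.pair_wf_digraph pair_wf_digraph
    by (intro digraph_iso_with_projI[where f = f]) (auto simp: G'_def)
  then show thesis
    using that G' by (simp add: G'_def)
qed

section \<open>The construction\<close>

text \<open>The numbers from \<open>n\<close> on form the clique. Each \<open>v\<close> below
  \<open>n\<close> is joined to an initial part of it, just long enough to raise its degree to
  \<open>2 * n\<close>; the last two sets are the two orientations of these edges.\<close>

definition clique_ext :: "nat pair_pre_digraph \<Rightarrow> nat \<Rightarrow> nat \<Rightarrow> nat pair_pre_digraph" where
  "clique_ext G n m = \<lparr>pverts = {..<n + m},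
     parcs = parcs G
       \<union> {(x, y). x \<noteq> y \<and> x \<in> {n..<n + m} \<and> y \<in> {n..<n + m}}
       \<union> {(v, x). v < n \<and> x \<in> {n..<n + (2 * n - card (nbrs G v))}}
       \<union> {(x, v). v < n \<and> x \<in> {n..<n + (2 * n - card (nbrs G v))}}\<rparr>"

text \<open>A vertex has fewer than \<open>n\<close> neighbours in \<open>G\<close>, so more than
  half of its \<open>2 * n\<close> neighbours lie in the clique. The bound on \<open>m\<close> makes
  room for them and makes the clique expensive to split.\<close>

lemma clique_extension_clique_ext:
  assumes "pair_graph G" "pverts G = {..<n}" "0 < n" "2 * n + 2 \<le> m"
  shows "clique_extension (clique_ext G n m) {..<n} {n..<n + m} (2 * n)"
proof -
  interpret G: pair_graph G by fact
  let ?H = "clique_ext G n m"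
  have lt: "u < n \<and> v < n \<and> u \<noteq> v" if "(u, v) \<in> parcs G" for u v
    using G.in_arcsD1[OF that] G.in_arcsD2[OF that] G.no_loops'[OF that] assms by auto
  define d where "d v = 2 * n - card (nbrs G v)" for v
  have "d v \<le> m" for v
    using assms by (simp add: d_def)
  then have d: "x < n + m" if "x < n + d v" for x v
    using that by (meson add_left_mono less_le_trans)
  have arcs: "(x, y) \<in> parcs ?H \<longleftrightarrow> (x, y) \<in> parcs G
      \<or> x \<noteq> y \<and> x \<in> {n..<n + m} \<and> y \<in> {n..<n + m}
      \<or> x < n \<and> y \<in> {n..<n + d x} \<or> y < n \<and> x \<in> {n..<n + d y}" for x y
    by (auto simp: clique_ext_def d_def)
  have verts: "pverts ?H = {..<n + m}"
    by (simp add: clique_ext_def)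
  have range: "x < n + m \<and> y < n + m \<and> x \<noteq> y" if "(x, y) \<in> parcs ?H" for x y
    using that lt[of x y] d[of y x] d[of x y] unfolding arcs by auto
  have "parcs ?H \<subseteq> {..<n + m} \<times> {..<n + m}"
    using range by auto
  then have fin: "finite (parcs ?H)"
    by (rule finite_subset) simp
  have sym: "(y, x) \<in> parcs ?H" if "(x, y) \<in> parcs ?H" for x y
    using that G.arcs_symmetric[of x y] unfolding arcs by blast
  have H: "pair_graph ?H"
    by unfold_locales
      (use fin range sym in \<open>auto simp: verts symmetric_def intro!: symI\<close>)
  have nbrs: "nbrs ?H v = nbrs G v \<union> {n..<n + d v}"
    "nbrs ?H v \<inter> {n..<n + m} = {n..<n + d v}"
    and disj: "nbrs G v \<inter> {n..<n + d v} = {}"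
    if v: "v < n" for v
  proof -
    show *: "nbrs ?H v = nbrs G v \<union> {n..<n + d v}"
      using v by (auto simp: nbrs_def arcs)
    have "nbrs G v \<subseteq> {..<n}"
      using lt by (auto simp: nbrs_def)
    then show "nbrs ?H v \<inter> {n..<n + m} = {n..<n + d v}" "nbrs G v \<inter> {n..<n + d v} = {}"
      unfolding * using d by fastforce+
  qed
  have deg: "card (nbrs G v) < n" if "v < n" for v
  proof -
    have "nbrs G v \<subset> {..<n}"
      using that lt by (auto simp: nbrs_def)
    then show ?thesis
      using psubset_card_mono[of "{..<n}" "nbrs G v"] by simp
  qed
  interpret H: pair_graph ?H by fact
  show ?thesis
  proof unfold_locales
    fix v assume "v \<in> {..<n}"
    then have v: "v < n"
      by simp
    show "card (nbrs ?H v) = 2 * n"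
      using deg[OF v] disj[OF v] G.finite_nbrs by (simp add: nbrs(1)[OF v] d_def card_Un_disjoint)
    show "2 * n < 2 * card (nbrs ?H v \<inter> {n..<n + m})"
      using deg[OF v] by (simp add: nbrs(2)[OF v] d_def)
  next
    show "{..<n} \<noteq> {}"
      using assms(3) by auto
    show "pverts ?H = {..<n} \<union> {n..<n + m}"
      unfolding verts by auto
    show "{..<n} \<inter> {n..<n + m} = {}"
      by auto
    show "(x, y) \<in> parcs ?H" if "x \<in> {n..<n + m}" "y \<in> {n..<n + m}" "x \<noteq> y" for x y
      using that unfolding arcs by blast
    show "Suc (2 * n) < card {n..<n + m}"
      using assms(4) by simp
  qed
qed

lemma mincut_graph_clique_ext:
  assumes "pair_graph G" "pverts G = {..<n}" "0 < n" "2 * n + 2 \<le> m"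
  shows "digraph_iso (with_proj (mincut_graph (clique_ext G n m))) (with_proj G)"
proof -
  let ?H = "clique_ext G n m"
  interpret G: pair_graph G by fact
  interpret H: clique_extension ?H "{..<n}" "{n..<n + m}" "2 * n"
    using assms by (rule clique_extension_clique_ext)
  interpret M: pair_graph "mincut_graph ?H"
    using H.pair_graph by (rule pair_graph_mincut_graph)
  \<comment> \<open>\<open>star\<close> sends vertices to mincuts, so the isomorphism is built in
    this direction and reversed at the end.\<close>
  have "digraph_iso (with_proj G) (with_proj (mincut_graph ?H))"
  proof (rule digraph_iso_with_projI)
    show "bij_betw (star ?H) (pverts G) (pverts (mincut_graph ?H))"
      using H.inj_on_star by (simp add: bij_betw_def assms mincut_graph_def H.mincut_iff_star)
    fix u v assume uv: "u \<in> pverts G" "v \<in> pverts G"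
    then have "(u, v) \<in> parcs ?H \<longleftrightarrow> (u, v) \<in> parcs G"
      using assms by (auto simp: clique_ext_def)
    moreover have "star ?H u = star ?H v \<longleftrightarrow> u = v"
      using uv assms by (intro inj_on_eq_iff[OF H.inj_on_star]) auto
    moreover have "star ?H u \<in> star ?H ` {..<n}" "star ?H v \<in> star ?H ` {..<n}"
      using uv assms by auto
    ultimately show "(star ?H u, star ?H v) \<in> parcs (mincut_graph ?H) \<longleftrightarrow> (u, v) \<in> parcs G"
      using H.stars_intersect_iff[of u v] G.no_loops'[of u v]
      by (cases "u = v") (auto simp: mincut_graph_def H.mincut_iff_star)
  qed (rule G.pair_wf_digraph M.pair_wf_digraph)+
  then show ?thesis
    by (rule digraph_iso_swap[OF G.wf_digraph])
qed

section \<open>Edgeless graphs and the final family\<close>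

lemma pair_graph_edgeless: "finite A \<Longrightarrow> pair_graph \<lparr>pverts = A, parcs = {}\<rparr>"
  by unfold_locales (simp_all add: symmetric_def sym_def)

text \<open>Such a graph is not connected: either \<open>A\<close> is empty, or no arc leaves the
  proper subset formed by one vertex.\<close>

lemma mincut_graph_edgeless:
  assumes "finite A" "card A \<noteq> 1"
  shows "mincut_graph \<lparr>pverts = A, parcs = {}\<rparr> = \<lparr>pverts = {}, parcs = {}\<rparr>"
proof -
  let ?H = "\<lparr>pverts = A, parcs = {}\<rparr>"
  interpret pair_graph ?H
    using assms(1) by (rule pair_graph_edgeless)
  have "\<not> connected (with_proj ?H)"
  proof
    assume conn: "connected (with_proj ?H)"
    then obtain a where "a \<in> A"
      unfolding connected_iff_arc_leaving by auto
    moreover have "A \<noteq> {a}"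
      using assms by auto
    ultimately have "{a} \<subset> A"
      by auto
    then show False
      using conn unfolding connected_iff_arc_leaving by auto
  qed
  then have "\<not> edge_cut ?H S" for S
    unfolding edge_cut_def by blast
  then show ?thesis
    by (simp add: mincut_graph_def mincut_def is_arg_min_def)
qed

theorem theorem4p7:
  fixes G :: "'a pair_pre_digraph"
  assumes "pair_graph G"
  shows "\<exists>\<F> :: nat pair_pre_digraph set.
           infinite \<F> \<and>
           (\<forall>H\<in>\<F>. pair_graph H \<and> digraph_iso (with_proj (mincut_graph H)) (with_proj G)) \<and>
           pairwise (\<lambda>H H'. \<not> digraph_iso (with_proj H) (with_proj H')) \<F>"
proof -
  \<comment> \<open>Both cases provide a family in which the vertex count grows with
    \<open>m\<close>; infinitude and non-isomorphism are then shown once for both.\<close>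
  obtain F :: "nat \<Rightarrow> nat pair_pre_digraph" and m0 c :: nat
    where F: "\<And>m. m0 \<le> m \<Longrightarrow>
        pair_graph (F m) \<and> digraph_iso (with_proj (mincut_graph (F m))) (with_proj G)"
      and card_F: "\<And>m. card (pverts (F m)) = c + m"
  proof (cases "pverts G = {}")
    case True
    interpret pair_graph G by fact
    have "parcs G = {}"
      using True in_arcsD1 by auto
    define F where "F m = \<lparr>pverts = {..<m::nat}, parcs = {}\<rparr>" for m
    have "pair_graph (F m) \<and> digraph_iso (with_proj (mincut_graph (F m))) (with_proj G)"
      if "2 \<le> m" for m
    proof
      show Fm: "pair_graph (F m)"
        by (simp add: F_def pair_graph_edgeless)
      have "mincut_graph (F m) = \<lparr>pverts = {}, parcs = {}\<rparr>"
        unfolding F_def using that by (intro mincut_graph_edgeless) auto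
      moreover have "pair_wf_digraph \<lparr>pverts = {}, parcs = {}\<rparr>"
        by unfold_locales auto
      ultimately show "digraph_iso (with_proj (mincut_graph (F m))) (with_proj G)"
        using True pair_wf_digraph
        \<comment> \<open>Both vertex sets are empty, so any function is a bijection between
          them.\<close>
        by (intro digraph_iso_with_projI[where f = undefined]) (auto simp: bij_betw_def)
    qed
    then show thesis
      by (rule that[of 2 F 0]) (simp_all add: F_def)
  next
    case False
    interpret pair_graph G by fact
    let ?n = "card (pverts G)"
    obtain G' :: "nat pair_pre_digraph" where G': "pair_graph G'" "pverts G' = {..<?n}"
      "digraph_iso (with_proj G') (with_proj G)"
      using assms by (rule ex_digraph_iso_lessThan)
    have n: "0 < ?n"
      using False pair_finite_verts by (simp add: card_gt_0_iff)
    have "pair_graph (clique_ext G' ?n m) \<and>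
        digraph_iso (with_proj (mincut_graph (clique_ext G' ?n m))) (with_proj G)"
      if m: "2 * ?n + 2 \<le> m" for m
      using clique_extension_clique_ext[OF G'(1,2) n m] mincut_graph_clique_ext[OF G'(1,2) n m] G'(3)
      by (auto simp: clique_extension_def intro: digraph_iso_trans)
    then show thesis
      by (rule that[of "2 * ?n + 2" "clique_ext G' ?n" ?n]) (simp_all add: clique_ext_def)
  qed
  have "inj F"
    using card_F by (metis add_left_cancel injI)
  then have "infinite (F ` {m0..})"
    by (simp add: finite_image_iff inj_on_subset infinite_Ici)
  moreover have "\<forall>H\<in>F ` {m0..}. pair_graph H \<and> digraph_iso (with_proj (mincut_graph H)) (with_proj G)"
    using F by auto
  moreover have "pairwise (\<lambda>H H'. \<not> digraph_iso (with_proj H) (with_proj H')) (F ` {m0..})"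
    \<comment> \<open>Isomorphic members have equal vertex counts \<open>c + m\<close>, hence the
      same index.\<close>
    by (auto simp: pairwise_def card_F dest!: digraph_iso_card_pverts)
  ultimately show ?thesis
    by blast
qed

end
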